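(* There exist constants $c>0$ and $n_0$ such that for every generic set $P$ of $n\ge n_0$ points in the plane there exists a subset $Q\subseteq P$ with $\operatorname{cr}(Q)\ge c\log^2 n$. (That is, $\operatorname{cr}(Q)\in\Omega(\log^2 n)$.)
   Context: A finite planar point set is in general position if no three of its points are collinear. It is generic if it is in general position and every subset of it has a unique (Euclidean) minimum spanning tree (MST); for a generic set $X$, $T_X$ denotes the MST of $X$, drawn with straight-line edges. For disjoint point sets $R,B$ with $R\cup B$ generic, $\operatorname{cr}(R,B)$ denotes the number of crossings between the edges of $T_R$ and the edges of $T_B$. For a generic point set $Q$, $\operatorname{cr}(Q)=\max \operatorname{cr}(R,B)$, the maximum over all partitions $Q=R\cup B$ into two disjoint sets. Logarithms are base $2$. *)

theory Defs
  imports "HOL-Analysis.Analysis"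
begin

type_synonym point = "real \<times> real"

text \<open>Points in the Euclidean plane: real \<times> real, whose dist is the Euclidean distance.
  Edges of a straight-line graph on a point set are 2-element sets of points.\<close>

definition all_edges :: "point set \<Rightarrow> point set set" where
  "all_edges X = {{a, b} | a b. a \<in> X \<and> b \<in> X \<and> a \<noteq> b}"

definition graph_connected :: "point set \<Rightarrow> point set set \<Rightarrow> bool" where
  "graph_connected X E \<longleftrightarrow>
     (\<forall>u\<in>X. \<forall>v\<in>X. (u, v) \<in> {(a, b). {a, b} \<in> E}\<^sup>*)"

text \<open>A spanning tree of X: a minimally connected spanning graph on vertex set X.\<close>
definition spanning_tree :: "point set \<Rightarrow> point set set \<Rightarrow> bool" where
  "spanning_tree X E \<longleftrightarrow> E \<subseteq> all_edges X \<and> graph_connected X E \<and>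
     (\<forall>e\<in>E. \<not> graph_connected X (E - {e}))"

definition edge_length :: "point set \<Rightarrow> real" where
  "edge_length e = Max ((\<lambda>(a, b). dist a b) ` (e \<times> e))"

definition tree_weight :: "point set set \<Rightarrow> real" where
  "tree_weight E = (\<Sum>e\<in>E. edge_length e)"

definition is_MST :: "point set \<Rightarrow> point set set \<Rightarrow> bool" where
  "is_MST X T \<longleftrightarrow> spanning_tree X T \<and>
     (\<forall>T'. spanning_tree X T' \<longrightarrow> tree_weight T \<le> tree_weight T')"

definition general_position :: "point set \<Rightarrow> bool" where
  "general_position X \<longleftrightarrow>
     (\<forall>a\<in>X. \<forall>b\<in>X. \<forall>c\<in>X. a \<noteq> b \<and> a \<noteq> c \<and> b \<noteq> c \<longrightarrow> \<not> collinear {a, b, c})"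

definition generic :: "point set \<Rightarrow> bool" where
  "generic X \<longleftrightarrow> finite X \<and> general_position X \<and> (\<forall>Y\<subseteq>X. \<exists>!T. is_MST Y T)"

text \<open>T_X, the (unique) MST of a generic set X.\<close>
definition MST :: "point set \<Rightarrow> point set set" where
  "MST X = (THE T. is_MST X T)"

text \<open>Number of crossing pairs (edge of T_R, edge of T_B); the segment of edge e is convex hull e.\<close>
definition cr_RB :: "point set \<Rightarrow> point set \<Rightarrow> nat" where
  "cr_RB R B = card {(e, f). e \<in> MST R \<and> f \<in> MST B \<and> convex hull e \<inter> convex hull f \<noteq> {}}"

definition cr :: "point set \<Rightarrow> nat" where
  "cr Q = Max {cr_RB R B | R B. R \<union> B = Q \<and> R \<inter> B = {}}"

end

theory Submission
  imports Defs
begin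

text \<open>Two sets are well separated if one is a small cluster and the other, seen from the cluster, is
  far away within a narrow sector. The MST of their union then contains both MSTs, so the crossings
  inside the two parts add up. Any point set contains two well separated subsets, each
  with a constant fraction \<open>1/K\<close> of the points, and any five points contain four in convex position,
  whose diagonals give one crossing. Iterating the splitting, \<open>5 K\<^sup>j\<close> points contain a subset with
  \<open>2\<^sup>j\<close> crossings; the resulting bound is even polynomial in \<open>n\<close>.\<close>

text \<open>New points can destroy edges of an MST, so colourings found in two parts cannot in
  general be merged. What makes the merge possible is the bottleneck criterion:
  \<open>{u, v}\<close> is an MST edge exactly if no chain of steps, each strictly shorter than
  \<open>dist u v\<close>, leads from \<open>u\<close> to \<open>v\<close>. It speaks of distances
  alone, so an MST survives an enlargement of its vertex set as soon as short chains through the new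
  points can be rerouted among the old ones. The two clauses of \<open>well_separated\<close>
  provide this rerouting for both parts. They pass to subsets, so the red and the blue trees can be
  treated independently, whatever the colouring is. Genericity supplies unique MSTs rather than
  distinct distances; a tie in the criterion is therefore refuted by constructing a second
  MST.\<close>

section \<open>Reachability in graphs given by edge sets\<close>

definition adj :: "point set set \<Rightarrow> (point \<times> point) set" where
  "adj E = {(a, b). {a, b} \<in> E}"

lemma graph_connected_adj: "graph_connected X E \<longleftrightarrow> (\<forall>u\<in>X. \<forall>v\<in>X. (u, v) \<in> (adj E)\<^sup>*)"
  by (simp add: graph_connected_def adj_def)

lemma sym_adj_rtrancl: "sym ((adj E)\<^sup>*)"
  by (intro sym_rtrancl symI) (auto simp: adj_def insert_commute)

lemmas adj_rtrancl_sym = symD[OF sym_adj_rtrancl]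

lemma adj_rtrancl_mono: "E \<subseteq> F \<Longrightarrow> p \<in> (adj E)\<^sup>* \<Longrightarrow> p \<in> (adj F)\<^sup>*"
  using rtrancl_mono[of "adj E" "adj F"] by (auto simp: adj_def)

text \<open>A walk can be shortened until it uses the edge \<open>{a, b}\<close> at most once; the
  cases are no use and one use in either direction.\<close>

lemma adj_insert_rtrancl_cases:
  assumes "(x, y) \<in> (adj (insert {a, b} E))\<^sup>*"
  shows "(x, y) \<in> (adj E)\<^sup>* \<or> (x, a) \<in> (adj E)\<^sup>* \<and> (b, y) \<in> (adj E)\<^sup>* \<or>
         (x, b) \<in> (adj E)\<^sup>* \<and> (a, y) \<in> (adj E)\<^sup>*"
  using assms
proof (induction rule: rtrancl_induct)
  case base
  then show ?case by simp
next
  case (step y z)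
  then have "(y, z) \<in> adj E \<or> y = a \<and> z = b \<or> y = b \<and> z = a"
    by (auto simp: adj_def doubleton_eq_iff)
  then show ?case using step.IH
    by (auto intro: rtrancl_into_rtrancl)
qed

text \<open>Every use of the edge \<open>{a, b}\<close> is replaced by the detour from
  \<open>a\<close> to \<open>b\<close> in \<open>F\<close>.\<close>

lemma graph_connected_exchange:
  assumes con: "graph_connected X (insert {a, b} E)"
    and sub: "E \<subseteq> F" and ab: "(a, b) \<in> (adj F)\<^sup>*"
  shows "graph_connected X F"
  unfolding graph_connected_adj
proof (intro ballI)
  fix x y assume "x \<in> X" "y \<in> X"
  then have "(x, y) \<in> (adj (insert {a, b} E))\<^sup>*"
    using con by (auto simp: graph_connected_adj)
  from adj_insert_rtrancl_cases[OF this] show "(x, y) \<in> (adj F)\<^sup>*"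
    using adj_rtrancl_mono[OF sub] ab adj_rtrancl_sym[OF ab] by (meson rtrancl_trans)
qed

section \<open>Spanning trees and exchange of edges\<close>

lemma finite_all_edges: "finite X \<Longrightarrow> finite (all_edges X)"
  by (rule finite_subset[of _ "Pow X"]) (auto simp: all_edges_def)

lemma edge_length_pair [simp]: "edge_length {a, b} = dist a b"
proof -
  have "(\<lambda>(a, b). dist a b) ` ({a, b} \<times> {a, b}) = {0, dist a b}"
    by (auto simp: dist_commute image_iff)
  then show ?thesis
    by (simp add: edge_length_def max_def)
qed

lemma edge_length_nonneg: "e \<in> all_edges X \<Longrightarrow> 0 \<le> edge_length e"
  by (auto simp: all_edges_def)

lemma spanning_tree_within_connected:
  assumes "finite X" "E \<subseteq> all_edges X" "graph_connected X E"
  obtains T where "T \<subseteq> E" "spanning_tree X T"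
proof -
  define S where "S = {T. T \<subseteq> E \<and> graph_connected X T}"
  have "finite E"
    using assms finite_all_edges finite_subset by blast
  then have "finite S" by (simp add: S_def)
  moreover have "E \<in> S" using assms by (simp add: S_def)
  ultimately obtain T where T: "T \<in> S" "\<And>T'. T' \<in> S \<Longrightarrow> T' \<subseteq> T \<Longrightarrow> T' = T"
    using finite_has_minimal2[of S E] by metis
  have "spanning_tree X T"
    unfolding spanning_tree_def
  proof (intro conjI ballI notI)
    show "T \<subseteq> all_edges X" using T assms by (auto simp: S_def)
    show "graph_connected X T" using T by (simp add: S_def)
    fix e assume "e \<in> T" "graph_connected X (T - {e})"
    then show False using T(1) T(2)[of "T - {e}"] by (auto simp: S_def)
  qed
  then show ?thesis using T that by (auto simp: S_def)
qed

lemma tree_weight_mono: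
  assumes "finite X" "F \<subseteq> all_edges X" "E \<subseteq> F"
  shows "tree_weight E \<le> tree_weight F"
  unfolding tree_weight_def
  using assms finite_subset[OF assms(2) finite_all_edges]
  by (intro sum_mono2) (auto intro: edge_length_nonneg)

lemma tree_weight_insert_le:
  assumes "finite E"
  shows "tree_weight (insert {a, b} E) \<le> tree_weight E + dist a b"
  using assms by (cases "{a, b} \<in> E") (auto simp: tree_weight_def insert_absorb)

lemma tree_weight_remove:
  assumes "finite E" "e \<in> E"
  shows "tree_weight (E - {e}) = tree_weight E - edge_length e"
  using assms by (simp add: tree_weight_def sum_diff1)

text \<open>The swapped graph is connected but perhaps not minimal. Some spanning tree
  \<open>T'\<close> inside it weighs no more, because lengths are nonnegative; this replaces any
  counting of edges or cycles. If the new edge is no longer than \<open>f\<close>, then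
  \<open>T'\<close> is itself an MST and avoids \<open>f\<close>, which is how uniqueness will be
  contradicted.\<close>

lemma MST_exchange:
  assumes fin: "finite X" and mst: "is_MST X T" and f: "f \<in> T"
    and ab: "a \<in> X" "b \<in> X" "a \<noteq> b"
    and con: "graph_connected X (insert {a, b} (T - {f}))"
  shows "edge_length f \<le> dist a b"
    and "dist a b \<le> edge_length f \<Longrightarrow> {a, b} \<noteq> f \<Longrightarrow> \<exists>T'. is_MST X T' \<and> T' \<noteq> T"
proof -
  have T: "T \<subseteq> all_edges X"
    using mst by (simp add: is_MST_def spanning_tree_def)
  then have finT: "finite T" using fin finite_all_edges finite_subset by blast
  have sub: "insert {a, b} (T - {f}) \<subseteq> all_edges X"
    using T ab unfolding all_edges_def by blast
  obtain T' where T': "T' \<subseteq> insert {a, b} (T - {f})" "spanning_tree X T'"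
    using spanning_tree_within_connected[OF fin sub con] .
  have "tree_weight T' \<le> tree_weight (insert {a, b} (T - {f}))"
    by (rule tree_weight_mono[OF fin sub T'(1)])
  also have "\<dots> \<le> tree_weight T - edge_length f + dist a b"
    using tree_weight_insert_le[of "T - {f}" a b] tree_weight_remove[OF finT f] finT by simp
  finally have w: "tree_weight T' \<le> tree_weight T - edge_length f + dist a b" .
  moreover have min: "tree_weight T \<le> tree_weight S" if "spanning_tree X S" for S
    using mst that by (simp add: is_MST_def)
  ultimately show "edge_length f \<le> dist a b" using T'(2) by fastforce
  assume "dist a b \<le> edge_length f" "{a, b} \<noteq> f"
  then have "tree_weight T' \<le> tree_weight T" "f \<notin> T'"
    using w T'(1) by auto
  then have "is_MST X T'" "T' \<noteq> T"
    using min T'(2) f unfolding is_MST_def by (blast intro: order_trans)+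
  then show "\<exists>T'. is_MST X T' \<and> T' \<noteq> T" by blast
qed

section \<open>Bottleneck criterion for MST edges\<close>

text \<open>The strict inequality matters: for \<open>d = dist u v\<close> the direct step from
  \<open>u\<close> to \<open>v\<close> is excluded.\<close>

definition short_steps :: "point set \<Rightarrow> real \<Rightarrow> (point \<times> point) set" where
  "short_steps X d = {(a, b). a \<in> X \<and> b \<in> X \<and> dist a b < d}"

text \<open>Deleting \<open>{u, v}\<close> separates \<open>u\<close> from \<open>v\<close> in the
  tree, so a chain of shorter steps would contain a step \<open>(a, b)\<close> across the cut, and
  swapping it in would give a lighter tree.\<close>

lemma MST_edge_not_short_connected:
  assumes fin: "finite X" and mst: "is_MST X T" and uv: "{u, v} \<in> T"
  shows "(u, v) \<notin> (short_steps X (dist u v))\<^sup>*"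
proof
  define E where "E = T - {{u, v}}"
  have st: "spanning_tree X T" using mst by (simp add: is_MST_def)
  have T: "insert {u, v} E = T" using uv by (auto simp: E_def)
  have con: "graph_connected X (insert {u, v} E)"
    using st T by (simp add: spanning_tree_def)
  have ncon: "\<not> graph_connected X E"
    using st uv by (simp add: spanning_tree_def E_def)
  assume "(u, v) \<in> (short_steps X (dist u v))\<^sup>*"
  moreover have "(u, v) \<notin> (adj E)\<^sup>*"
    using graph_connected_exchange[OF con subset_refl] ncon by blast
  ultimately have "\<not> short_steps X (dist u v) \<subseteq> (adj E)\<^sup>*"
    using rtrancl_subset_rtrancl by blast
  then obtain a b where ab: "a \<in> X" "b \<in> X" "dist a b < dist u v" "(a, b) \<notin> (adj E)\<^sup>*"
    by (auto simp: short_steps_def)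
  define F where "F = insert {a, b} E"
  have "(a, b) \<in> (adj (insert {u, v} E))\<^sup>*"
    using con ab by (simp add: graph_connected_adj)
  from adj_insert_rtrancl_cases[OF this] ab(4)
  have "(a, u) \<in> (adj E)\<^sup>* \<and> (v, b) \<in> (adj E)\<^sup>* \<or> (a, v) \<in> (adj E)\<^sup>* \<and> (u, b) \<in> (adj E)\<^sup>*"
    by blast
  moreover have F: "E \<subseteq> F" by (auto simp: F_def)
  ultimately have "(a, u) \<in> (adj F)\<^sup>* \<and> (v, b) \<in> (adj F)\<^sup>* \<or> (a, v) \<in> (adj F)\<^sup>* \<and> (u, b) \<in> (adj F)\<^sup>*"
    using adj_rtrancl_mono[OF F] by blast
  moreover have "(a, b) \<in> (adj F)\<^sup>*" by (rule r_into_rtrancl) (simp add: F_def adj_def)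
  ultimately have "(u, v) \<in> (adj F)\<^sup>*"
    by (meson adj_rtrancl_sym rtrancl_trans)
  then have "graph_connected X F"
    using graph_connected_exchange[OF con F] by blast
  moreover have "a \<noteq> b" using ab(4) by auto
  ultimately have "dist u v \<le> dist a b"
    using MST_exchange(1)[OF fin mst uv ab(1,2)] by (simp add: F_def E_def)
  then show False using ab(3) by simp
qed

text \<open>Otherwise an edge \<open>f\<close> on the tree path from \<open>u\<close> to
  \<open>v\<close> is at least \<open>dist u v\<close> long, and exchanging it for
  \<open>{u, v}\<close> gives a second MST.\<close>

lemma not_short_connected_MST_edge:
  assumes fin: "finite X" and mst: "is_MST X T" and unique: "\<And>T'. is_MST X T' \<Longrightarrow> T' = T"
    and uv: "u \<in> X" "v \<in> X" "u \<noteq> v" "(u, v) \<notin> (short_steps X (dist u v))\<^sup>*"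
  shows "{u, v} \<in> T"
proof (rule ccontr)
  assume uvT: "{u, v} \<notin> T"
  have T: "T \<subseteq> all_edges X" "graph_connected X T"
    using mst by (auto simp: is_MST_def spanning_tree_def)
  then have finT: "finite T" using fin finite_all_edges finite_subset by blast
  \<comment> \<open>A maximal member \<open>E\<close> of \<open>S\<close> spares talking about the
    tree path: adding any tree edge missing from \<open>E\<close> joins \<open>u\<close> to
    \<open>v\<close>, and such an edge is at least \<open>dist u v\<close> long, as \<open>E\<close>
    keeps all shorter ones.\<close>
  define S where "S = {E. {e\<in>T. edge_length e < dist u v} \<subseteq> E \<and> E \<subseteq> T \<and> (u, v) \<notin> (adj E)\<^sup>*}"
  have "finite S" by (rule finite_subset[of _ "Pow T"]) (auto simp: S_def finT)
  moreover have "{e\<in>T. edge_length e < dist u v} \<in> S"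
  proof -
    have "adj {e\<in>T. edge_length e < dist u v} \<subseteq> short_steps X (dist u v)"
      using T(1) by (auto simp: adj_def short_steps_def all_edges_def doubleton_eq_iff)
    then show ?thesis using uv(4) rtrancl_mono by (auto simp: S_def)
  qed
  ultimately obtain E where E: "E \<in> S" "\<And>E'. E' \<in> S \<Longrightarrow> E \<subseteq> E' \<Longrightarrow> E' = E"
    using finite_has_maximal2[of S] by metis
  have "E \<noteq> T" using E(1) T(2) uv by (auto simp: S_def graph_connected_adj)
  then obtain f where f: "f \<in> T" "f \<notin> E" using E(1) by (auto simp: S_def)
  then obtain a b where ab: "f = {a, b}" "a \<in> X" "b \<in> X" using T by (auto simp: all_edges_def)
  have "insert f E \<notin> S" using E f by blast
  then have "(u, v) \<in> (adj (insert {a, b} E))\<^sup>*" using E(1) f ab by (auto simp: S_def)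
  from adj_insert_rtrancl_cases[OF this]
  have "(u, a) \<in> (adj E)\<^sup>* \<and> (b, v) \<in> (adj E)\<^sup>* \<or> (u, b) \<in> (adj E)\<^sup>* \<and> (a, v) \<in> (adj E)\<^sup>*"
    using E(1) by (auto simp: S_def)
  moreover define F where "F = insert {u, v} (T - {f})"
  moreover have EF: "E \<subseteq> F" using E(1) f by (auto simp: F_def S_def)
  ultimately have "(u, a) \<in> (adj F)\<^sup>* \<and> (b, v) \<in> (adj F)\<^sup>* \<or> (u, b) \<in> (adj F)\<^sup>* \<and> (a, v) \<in> (adj F)\<^sup>*"
    using adj_rtrancl_mono[OF EF] by blast
  moreover have "(u, v) \<in> (adj F)\<^sup>*" by (rule r_into_rtrancl) (simp add: F_def adj_def)
  ultimately have abF: "(a, b) \<in> (adj F)\<^sup>*"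
    by (meson adj_rtrancl_sym rtrancl_trans)
  have "insert {a, b} (T - {f}) = T" using f ab by auto
  then have "graph_connected X F"
    using graph_connected_exchange[of X a b "T - {f}" F] T abF by (auto simp: F_def)
  moreover have "dist u v \<le> edge_length f" using E(1) f by (force simp: S_def)
  moreover have "{u, v} \<noteq> f" using uvT f by auto
  ultimately show False
    using MST_exchange(2)[OF fin mst f(1) uv(1-3)] unique by (auto simp: F_def)
qed

lemma generic_subset:
  assumes "generic P" and sub: "Q \<subseteq> P"
  shows "generic Q"
proof -
  have "finite P" and gp: "general_position P" and ex: "\<And>Y. Y \<subseteq> P \<Longrightarrow> \<exists>!T. is_MST Y T"
    using assms by (simp_all add: generic_def)
  have "finite Q" by (rule finite_subset[OF sub \<open>finite P\<close>])
  moreover have "general_position Q"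
    using gp sub unfolding general_position_def by blast
  moreover have "\<forall>Y\<subseteq>Q. \<exists>!T. is_MST Y T"
    using ex[OF subset_trans[OF _ sub]] by simp
  ultimately show ?thesis by (simp add: generic_def)
qed

lemma generic_MST:
  assumes "generic X"
  shows "is_MST X (MST X)" "is_MST X T \<Longrightarrow> T = MST X"
proof -
  have ex: "\<exists>!T. is_MST X T" using assms by (auto simp: generic_def)
  show "is_MST X (MST X)" unfolding MST_def by (rule theI'[OF ex])
  then show "is_MST X T \<Longrightarrow> T = MST X" using ex by blast
qed

lemma MST_edges: "generic X \<Longrightarrow> MST X \<subseteq> all_edges X"
  using generic_MST(1) by (auto simp: is_MST_def spanning_tree_def)

lemma finite_MST: "generic X \<Longrightarrow> finite (MST X)"
  by (rule finite_subset[OF MST_edges finite_all_edges]) (simp_all add: generic_def)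

lemma MST_edge_iff:
  assumes gen: "generic X" and uv: "u \<in> X" "v \<in> X" "u \<noteq> v"
  shows "{u, v} \<in> MST X \<longleftrightarrow> (u, v) \<notin> (short_steps X (dist u v))\<^sup>*"
proof -
  have "finite X" using gen by (simp add: generic_def)
  then show ?thesis
    using not_short_connected_MST_edge[OF _ generic_MST[OF gen] uv]
      MST_edge_not_short_connected[OF _ generic_MST(1)[OF gen]] by blast
qed

section \<open>Well separated sets\<close>

text \<open>The relation is not symmetric: \<open>X\<close> is the cluster and \<open>Y\<close> the
  distant part. The second clause says that a detour from \<open>y\<close> into the cluster at
  \<open>x\<close> and out again from \<open>x'\<close> to \<open>y'\<close> has a link at least as
  long as the direct step; entry and exit may differ, so \<open>x\<close> and \<open>x'\<close> vary
  independently.\<close>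

definition well_separated :: "point set \<Rightarrow> point set \<Rightarrow> bool" where
  "well_separated X Y \<longleftrightarrow>
     (\<forall>x\<in>X. \<forall>x'\<in>X. \<forall>y\<in>Y. dist x x' < dist x y) \<and>
     (\<forall>x\<in>X. \<forall>x'\<in>X. \<forall>y\<in>Y. \<forall>y'\<in>Y. dist y y' \<le> max (dist x y) (dist x' y'))"

lemma well_separated_subset:
  "well_separated X Y \<Longrightarrow> X' \<subseteq> X \<Longrightarrow> Y' \<subseteq> Y \<Longrightarrow> well_separated X' Y'"
  unfolding well_separated_def by blast

lemma well_separated_disjoint: "well_separated X Y \<Longrightarrow> X \<inter> Y = {}"
  unfolding well_separated_def by fastforce

text \<open>If some link to \<open>Y\<close> is shorter than \<open>d\<close>, its end
  \<open>x\<close> in the cluster is within \<open>d\<close> of all of \<open>X\<close>, and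
  \<open>u\<close> reaches \<open>v\<close> through \<open>x\<close>. Otherwise the chain never
  leaves \<open>X\<close>.\<close>

lemma short_connected_cluster:
  assumes sep: "well_separated X Y" and uv: "u \<in> X" "v \<in> X"
    and path: "(u, v) \<in> (short_steps (X \<union> Y) d)\<^sup>*"
  shows "(u, v) \<in> (short_steps X d)\<^sup>*"
proof (cases "\<exists>x\<in>X. \<exists>y\<in>Y. dist x y < d")
  case True
  then obtain x y where xy: "x \<in> X" "y \<in> Y" "dist x y < d" by blast
  have x: "dist x x' < d" if "x' \<in> X" for x'
    using sep xy that unfolding well_separated_def by force
  then have "(u, x) \<in> short_steps X d" "(x, v) \<in> short_steps X d"
    using uv xy(1) x by (auto simp: short_steps_def dist_commute)
  then show ?thesis by (meson r_into_rtrancl rtrancl_trans)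
next
  case False
  have "(u, v) \<in> (short_steps X d)\<^sup>* \<and> v \<in> X"
    using path
  proof (induction rule: rtrancl_induct)
    case base
    then show ?case using uv by simp
  next
    case (step y z)
    then have "(y, z) \<in> short_steps X d" using False by (auto simp: short_steps_def)
    then show ?case using step.IH by (auto simp: short_steps_def intro: rtrancl_into_rtrancl)
  qed
  then show ?thesis by simp
qed

lemma short_connected_far:
  assumes sep: "well_separated X Y" and uv: "u \<in> Y" "v \<in> Y"
    and path: "(u, v) \<in> (short_steps (X \<union> Y) d)\<^sup>*"
  shows "(u, v) \<in> (short_steps Y d)\<^sup>*"
proof -
  \<comment> \<open>While the chain is inside \<open>X\<close>, the invariant remembers a point
    \<open>y\<close> already reached within \<open>Y\<close> that has a short link into
    \<open>X\<close>. When the chain returns to \<open>Y\<close>, the second clause of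
    \<open>well_separated\<close> allows a direct step from \<open>y\<close>.\<close>
  have "(v \<in> Y \<longrightarrow> (u, v) \<in> (short_steps Y d)\<^sup>*) \<and>
     (v \<in> X \<longrightarrow> (\<exists>y\<in>Y. \<exists>x\<in>X. (u, y) \<in> (short_steps Y d)\<^sup>* \<and> dist x y < d))"
    using path
  proof (induction rule: rtrancl_induct)
    case base
    then show ?case using uv well_separated_disjoint[OF sep] by auto
  next
    case (step w z)
    have wz: "w \<in> X \<union> Y" "z \<in> X \<union> Y" "dist w z < d"
      using step.hyps(2) by (auto simp: short_steps_def)
    show ?case
    proof (intro conjI impI)
      assume z: "z \<in> Y"
      have "\<exists>y\<in>Y. (u, y) \<in> (short_steps Y d)\<^sup>* \<and> dist y z < d"
      proof (cases "w \<in> Y")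
        case True
        then show ?thesis using step.IH wz by blast
      next
        case False
        then obtain y x where yx: "y \<in> Y" "x \<in> X" "(u, y) \<in> (short_steps Y d)\<^sup>*" "dist x y < d"
          using step.IH wz by blast
        have "dist y z \<le> max (dist x y) (dist w z)"
          using sep yx(1,2) False wz z by (auto simp: well_separated_def)
        then show ?thesis using yx wz by auto
      qed
      then show "(u, z) \<in> (short_steps Y d)\<^sup>*"
        using z by (auto simp: short_steps_def intro: rtrancl_into_rtrancl)
    next
      assume z: "z \<in> X"
      show "\<exists>y\<in>Y. \<exists>x\<in>X. (u, y) \<in> (short_steps Y d)\<^sup>* \<and> dist x y < d"
      proof (cases "w \<in> Y")
        case True
        then show ?thesis using step.IH wz z by (metis dist_commute)
      next
        case False
        then show ?thesis using step.IH wz by blast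
      qed
    qed
  qed
  then show ?thesis using uv by blast
qed

lemma MST_well_separated:
  assumes gen: "generic (X \<union> Y)" and sep: "well_separated X Y"
  shows "MST X \<union> MST Y \<subseteq> MST (X \<union> Y)"
proof -
  have "MST Z \<subseteq> MST (X \<union> Y)"
    if Z: "Z \<subseteq> X \<union> Y"
      "\<And>u v. u \<in> Z \<Longrightarrow> v \<in> Z \<Longrightarrow> (u, v) \<in> (short_steps (X \<union> Y) (dist u v))\<^sup>* \<Longrightarrow>
         (u, v) \<in> (short_steps Z (dist u v))\<^sup>*" for Z
  proof
    fix e assume e: "e \<in> MST Z"
    have genZ: "generic Z" using gen Z(1) generic_subset by blast
    obtain u v where uv: "e = {u, v}" "u \<in> Z" "v \<in> Z" "u \<noteq> v"
      using MST_edges[OF genZ] e by (auto simp: all_edges_def)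
    have "(u, v) \<notin> (short_steps Z (dist u v))\<^sup>*"
      using e uv(1) MST_edge_iff[OF genZ uv(2-4)] by simp
    then have "(u, v) \<notin> (short_steps (X \<union> Y) (dist u v))\<^sup>*"
      using Z(2)[OF uv(2,3)] by blast
    moreover have "u \<in> X \<union> Y" "v \<in> X \<union> Y" using uv(2,3) Z(1) by auto
    ultimately show "e \<in> MST (X \<union> Y)"
      using MST_edge_iff[OF gen _ _ uv(4)] uv(1) by simp
  qed
  from this[OF Un_upper1 short_connected_cluster[OF sep]] this[OF Un_upper2 short_connected_far[OF sep]]
  show ?thesis by blast
qed

lemma finite_crossings:
  assumes "generic R" "generic B"
  shows "finite {(e, f). e \<in> MST R \<and> f \<in> MST B \<and> convex hull e \<inter> convex hull f \<noteq> {}}"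
  by (rule finite_subset[of _ "MST R \<times> MST B"]) (auto simp: finite_MST assms)

text \<open>Edges of the two parts are nonempty subsets of the disjoint sets \<open>X\<close> and
  \<open>Y\<close>, so no crossing is counted twice. Any further crossings in the union are
  ignored.\<close>

lemma cr_RB_well_separated:
  assumes gen: "generic P" and sep: "well_separated X Y" and sub: "X \<subseteq> P" "Y \<subseteq> P"
    and R: "R1 \<subseteq> X" "R2 \<subseteq> Y" and B: "B1 \<subseteq> X" "B2 \<subseteq> Y"
  shows "cr_RB R1 B1 + cr_RB R2 B2 \<le> cr_RB (R1 \<union> R2) (B1 \<union> B2)"
proof -
  define C where
    "C R B = {(e, f). e \<in> MST R \<and> f \<in> MST B \<and> convex hull e \<inter> convex hull f \<noteq> {}}" for R B
  have "R1 \<subseteq> P" "R2 \<subseteq> P" "B1 \<subseteq> P" "B2 \<subseteq> P" "R1 \<union> R2 \<subseteq> P" "B1 \<union> B2 \<subseteq> P"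
    using R B sub by auto
  note g = this[THEN generic_subset[OF gen]]
  have "MST R1 \<union> MST R2 \<subseteq> MST (R1 \<union> R2)" "MST B1 \<union> MST B2 \<subseteq> MST (B1 \<union> B2)"
    using MST_well_separated[OF g(5) well_separated_subset[OF sep R]]
      MST_well_separated[OF g(6) well_separated_subset[OF sep B]] by blast+
  then have "C R1 B1 \<union> C R2 B2 \<subseteq> C (R1 \<union> R2) (B1 \<union> B2)"
    by (auto simp: C_def)
  moreover have "C R1 B1 \<inter> C R2 B2 = {}"
  proof -
    have "e \<subseteq> X \<and> e \<noteq> {}" if "e \<in> MST R1" for e
      using that MST_edges[OF g(1)] R(1) unfolding all_edges_def by blast
    moreover have "e \<subseteq> Y" if "e \<in> MST R2" for e
      using that MST_edges[OF g(2)] R(2) unfolding all_edges_def by blast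
    ultimately have "MST R1 \<inter> MST R2 = {}"
      using well_separated_disjoint[OF sep] by blast
    then show ?thesis by (auto simp: C_def)
  qed
  moreover have "finite (C R1 B1)" "finite (C R2 B2)" "finite (C (R1 \<union> R2) (B1 \<union> B2))"
    using g finite_crossings by (auto simp: C_def)
  ultimately have "card (C R1 B1) + card (C R2 B2) \<le> card (C (R1 \<union> R2) (B1 \<union> B2))"
    using card_mono[of "C (R1 \<union> R2) (B1 \<union> B2)" "C R1 B1 \<union> C R2 B2"]
    by (simp add: card_Un_disjoint)
  then show ?thesis by (simp add: cr_RB_def C_def)
qed

lemma MST_pair:
  assumes "generic {a, b}" "a \<noteq> b"
  shows "{a, b} \<in> MST {a, b}"
proof (rule ccontr)
  assume "{a, b} \<notin> MST {a, b}"
  moreover have "MST {a, b} \<subseteq> {{a, b}}"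
    using MST_edges[OF assms(1)] by (fastforce simp: all_edges_def)
  ultimately have "MST {a, b} = {}" by blast
  then show False
    using generic_MST(1)[OF assms(1)] assms(2)
    by (auto simp: is_MST_def spanning_tree_def graph_connected_def)
qed

section \<open>A crossing among five points\<close>

text \<open>Radon's theorem splits four points of the plane into two parts with intersecting hulls.
  The sizes are 2 and 2, which is a crossing, or 1 and 3, which is a nested point.\<close>

lemma Radon_four_points:
  fixes C :: "point set"
  assumes card: "card C = 4"
  obtains M N where "M \<inter> N = {}" "M \<union> N = C" "card M = 2" "card N = 2"
      "convex hull M \<inter> convex hull N \<noteq> {}"
    | x where "x \<in> C" "x \<in> convex hull (C - {x})"
proof -
  have fin: "finite C" using card by (intro card_ge_0_finite) simp
  have "affine_dependent C"
    by (rule affine_dependent_biggerset[OF fin]) (simp add: card)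
  from Radon_partition[OF fin this] obtain M N where
    MN: "M \<inter> N = {}" "M \<union> N = C" "convex hull M \<inter> convex hull N \<noteq> {}" by blast
  have finMN: "finite M" "finite N" using MN(2) fin by auto
  have "card M + card N = 4" using MN card finMN card_Un_disjoint by metis
  moreover have "card M \<noteq> 0" "card N \<noteq> 0" using MN(3) finMN by auto
  ultimately consider "card M = 2" "card N = 2" | "card M = 1" | "card N = 1" by linarith
  then show ?thesis
  proof cases
    case 1
    then show ?thesis using that(1) MN by blast
  next
    case 2
    then obtain x where x: "M = {x}" by (auto simp: card_1_singleton_iff)
    then have "N = C - {x}" using MN by blast
    then show ?thesis using that(2)[of x] x MN by auto
  next
    case 3
    then obtain x where x: "N = {x}" by (auto simp: card_1_singleton_iff)
    then have "M = C - {x}" using MN by blast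
    then show ?thesis using that(2)[of x] x MN by auto
  qed
qed

text \<open>This is the cross product of \<open>q - p\<close> and \<open>x - p\<close>, twice the
  signed area of the triangle \<open>p\<close>, \<open>q\<close>, \<open>x\<close>; its sign tells
  on which side of the line through \<open>p\<close> and \<open>q\<close> the point \<open>x\<close>
  lies.\<close>

definition side :: "point \<Rightarrow> point \<Rightarrow> point \<Rightarrow> real" where
  "side p q x = (fst q - fst p) * (snd x - snd p) - (snd q - snd p) * (fst x - fst p)"

lemma side_self [simp]: "side p q p = 0" "side p q q = 0"
  by (auto simp: side_def)

lemma side_affine:
  assumes "u + v + w = 1"
  shows "side p q (u *\<^sub>R a + v *\<^sub>R b + w *\<^sub>R c) = u * side p q a + v * side p q b + w * side p q c"
proof -
  have w: "w = 1 - u - v" using assms by simp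
  show ?thesis unfolding side_def w by (simp add: algebra_simps)
qed

lemma side_eq_0_collinear:
  assumes "p \<noteq> q" "side p q x = 0"
  shows "collinear {p, q, x}"
proof -
  define a b where "a = fst q - fst p" and "b = snd q - snd p"
  have nz: "a\<^sup>2 + b\<^sup>2 \<noteq> 0"
    using assms(1) by (auto simp: a_def b_def prod_eq_iff sum_power2_eq_zero_iff)
  have eq: "a * (snd x - snd p) = b * (fst x - fst p)"
    using assms(2) by (simp add: side_def a_def b_def)
  \<comment> \<open>The coefficient of the orthogonal projection of \<open>x - p\<close> onto
    \<open>q - p\<close>; a quotient of single coordinates would force a case distinction, as
    \<open>a\<close> or \<open>b\<close> may vanish.\<close>
  define t where "t = (a * (fst x - fst p) + b * (snd x - snd p)) / (a\<^sup>2 + b\<^sup>2)"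
  have "(a\<^sup>2 + b\<^sup>2) * (fst x - fst p) = a * (a * (fst x - fst p) + b * (snd x - snd p))"
    using eq by algebra
  then have 1: "fst x - fst p = t * a" using nz by (simp add: t_def field_simps)
  have "(a\<^sup>2 + b\<^sup>2) * (snd x - snd p) = b * (a * (fst x - fst p) + b * (snd x - snd p))"
    using eq by algebra
  then have 2: "snd x - snd p = t * b" using nz by (simp add: t_def field_simps)
  have "x - p = t *\<^sub>R (q - p)" using 1 2 by (simp add: prod_eq_iff a_def b_def)
  then have "collinear {0, q - p, x - p}" by (auto simp: collinear_lemma)
  then have "collinear {q, p, x}" by (simp add: collinear_3[of q p x])
  then show ?thesis by (simp add: insert_commute)
qed

text \<open>\<open>side p q\<close> has the same strict sign at \<open>a\<close> and
  \<open>b\<close>, so a convex combination on the line through \<open>p\<close> and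
  \<open>q\<close> gives both of them weight zero and equals the third vertex.\<close>

lemma same_side_not_in_hull:
  assumes "side p q a * side p q b > 0" "p \<noteq> q"
  shows "p \<notin> convex hull {a, b, q}" "q \<notin> convex hull {a, b, p}"
proof -
  have "z = y" if z: "z \<in> convex hull {a, b, y}" and s: "side p q y = 0" "side p q z = 0" for y z
  proof -
    obtain u v w where uvw: "0 \<le> u" "0 \<le> v" "0 \<le> w" "u + v + w = 1"
      "z = u *\<^sub>R a + v *\<^sub>R b + w *\<^sub>R y"
      using z by (auto simp: convex_hull_3)
    have "u * side p q a + v * side p q b = 0"
      using side_affine[OF uvw(4), of p q a b y] uvw(5) s by simp
    moreover have "side p q a > 0 \<and> side p q b > 0 \<or> side p q a < 0 \<and> side p q b < 0"
      using assms(1) by (auto simp: zero_less_mult_iff)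
    ultimately have "u = 0" "v = 0"
      using uvw(1,2) by (smt (verit) mult_nonneg_nonneg mult_nonneg_nonpos mult_pos_pos mult_pos_neg)+
    then show "z = y" using uvw by simp
  qed
  from this[of p q] this[of q p] assms(2)
  show "p \<notin> convex hull {a, b, q}" "q \<notin> convex hull {a, b, p}" by auto
qed

lemma two_of_three_same_sign:
  fixes f :: "'a \<Rightarrow> real"
  assumes "card T = 3" "\<And>x. x \<in> T \<Longrightarrow> f x \<noteq> 0"
  obtains a b where "a \<in> T" "b \<in> T" "a \<noteq> b" "f a * f b > 0"
proof -
  obtain x y z where T: "T = {x, y, z}" "x \<noteq> y" "x \<noteq> z" "y \<noteq> z"
    using assms(1) by (auto simp: card_3_iff)
  then have "f x \<noteq> 0" "f y \<noteq> 0" "f z \<noteq> 0" using assms(2) by auto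
  then have "f x * f y > 0 \<or> f x * f z > 0 \<or> f y * f z > 0"
    by (auto simp: zero_less_mult_iff)
  then show ?thesis using that T by blast
qed

text \<open>A vertex of a simplex is an extreme point, so removing it leaves a convex set, which
  still contains \<open>S\<close>.\<close>

lemma vertex_not_in_hull_of_inner_points:
  fixes T :: "point set"
  assumes "\<not> affine_dependent T" "a \<in> T" "S \<subseteq> convex hull T" "a \<notin> S"
  shows "a \<notin> convex hull S"
proof -
  have "a extreme_point_of (convex hull T)"
    using assms extreme_point_of_convex_hull_affine_independent by blast
  then have "convex (convex hull T - {a})"
    using extreme_point_of_stillconvex convex_convex_hull by blast
  then have "convex hull S \<subseteq> convex hull T - {a}"
    using assms by (intro hull_minimal) auto
  then show ?thesis by blast
qed

text \<open>Esther Klein's argument: if no four points are in convex position, all points lie in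
  an inclusion-maximal triangle, and the line through two of them leaves two of its vertices on the
  same side.\<close>
lemma five_points_crossing_pairs:
  fixes P :: "point set"
  assumes fin: "finite P" and gp: "general_position P" and card: "card P \<ge> 5"
  obtains M N where "M \<subseteq> P" "N \<subseteq> P" "M \<inter> N = {}" "card M = 2" "card N = 2"
    "convex hull M \<inter> convex hull N \<noteq> {}"
proof (rule ccontr)
  note found = that
  assume "\<not> thesis"
  then have nocross: "convex hull M \<inter> convex hull N = {}"
    if "M \<subseteq> P" "N \<subseteq> P" "M \<inter> N = {}" "card M = 2" "card N = 2" for M N
    using found[OF that] by blast
  have nested: "\<exists>x\<in>C. x \<in> convex hull (C - {x})" if C: "C \<subseteq> P" "card C = 4" for C
  proof (rule Radon_four_points[OF C(2)])
    fix M N assume "M \<inter> N = {}" "M \<union> N = C" "card M = 2" "card N = 2"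
      "convex hull M \<inter> convex hull N \<noteq> {}"
    then show ?thesis using nocross[of M N] C(1) by blast
  qed blast
  define \<T> where "\<T> = {T. T \<subseteq> P \<and> card T = 3}"
  have "finite \<T>" by (rule finite_subset[of _ "Pow P"]) (auto simp: \<T>_def fin)
  moreover have "\<T> \<noteq> {}"
    using obtain_subset_with_card_n[of 3 P] card by (auto simp: \<T>_def)
  ultimately obtain H where H: "H \<in> (hull) convex ` \<T>"
    and H_max: "\<And>H'. H' \<in> (hull) convex ` \<T> \<Longrightarrow> H \<subseteq> H' \<Longrightarrow> H = H'"
    using finite_has_maximal[of "(hull) convex ` \<T>"] by blast
  from H obtain T where T: "T \<in> \<T>" and "H = convex hull T" by blast
  with H_max have max: "convex hull T = convex hull T'"
    if "T' \<in> \<T>" "convex hull T \<subseteq> convex hull T'" for T'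
    using that by blast
  have T3: "T \<subseteq> P" "card T = 3" "finite T"
    using T fin by (auto simp: \<T>_def intro: finite_subset)
  \<comment> \<open>Among \<open>q\<close> and the vertices of \<open>T\<close> one point is nested.
    If it is a vertex, exchanging it for \<open>q\<close> gives a triangle containing the old one;
    by maximality the hulls agree, so \<open>q\<close> lies in the old one.\<close>
  have inside: "q \<in> convex hull T" if q: "q \<in> P" for q
  proof (cases "q \<in> T")
    case True
    then show ?thesis by (rule hull_inc)
  next
    case False
    have "card (insert q T) = 4" using False T3 by simp
    then obtain x where x: "x \<in> insert q T" "x \<in> convex hull (insert q T - {x})"
      using nested[of "insert q T"] q T3(1) by blast
    show ?thesis
    proof (cases "x = q")
      case True
      then show ?thesis using x False by simp
    next
      case xq: False
      let ?T = "insert q T - {x}"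
      have "T \<subseteq> convex hull ?T"
        using x(2) hull_subset[of ?T convex] by blast
      then have "convex hull T \<subseteq> convex hull ?T"
        by (rule hull_minimal) (rule convex_convex_hull)
      moreover have "?T \<in> \<T>"
        using x(1) xq False T3 q by (auto simp: \<T>_def card_Diff_singleton)
      ultimately have "convex hull T = convex hull ?T" using max by blast
      then show ?thesis using hull_inc[of q ?T convex] xq by auto
    qed
  qed
  then have PT: "P \<subseteq> convex hull T" by blast
  \<comment> \<open>This is where five points are used: two of them remain besides the vertices of
    \<open>T\<close>.\<close>
  have "card (P - T) \<ge> 2" using card T3 card_Diff_subset[of T P] by simp
  then obtain D where "D \<subseteq> P - T" "card D = 2"
    using obtain_subset_with_card_n by metis
  then obtain p q where pq: "p \<in> P - T" "q \<in> P - T" "p \<noteq> q"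
    by (auto simp: card_2_iff)
  have "side p q x \<noteq> 0" if "x \<in> T" for x
  proof
    assume "side p q x = 0"
    then have "collinear {p, q, x}" using side_eq_0_collinear pq by blast
    moreover have "x \<in> P" "p \<noteq> x" "q \<noteq> x" using that pq T3 by auto
    ultimately show False
      using gp pq(3) pq(1)[THEN DiffD1] pq(2)[THEN DiffD1] unfolding general_position_def by blast
  qed
  then obtain a b where ab: "a \<in> T" "b \<in> T" "a \<noteq> b" "side p q a * side p q b > 0"
    using two_of_three_same_sign[OF T3(2), of "side p q"] by metis
  have dist: "p \<noteq> a" "p \<noteq> b" "q \<noteq> a" "q \<noteq> b" using ab(1,2) pq(1,2) by blast+
  have indep: "\<not> affine_dependent T"
  proof -
    obtain x y z where xyz: "T = {x, y, z}" "x \<noteq> y" "x \<noteq> z" "y \<noteq> z"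
      using T3(2) by (auto simp: card_3_iff)
    then have "\<not> collinear {x, y, z}" using gp T3(1) unfolding general_position_def by auto
    then show ?thesis using xyz collinear_3_eq_affine_dependent by blast
  qed
  have P: "a \<in> P" "b \<in> P" "p \<in> P" "q \<in> P" using ab pq T3(1) by blast+
  then have "{a, b, p, q} \<subseteq> P" by blast
  moreover have "card {a, b, p, q} = 4"
    using ab(3) dist pq(3) by (simp add: eq_commute)
  \<comment> \<open>No candidate for the nested point survives: \<open>a\<close> and
    \<open>b\<close> are vertices of a triangle containing all points, while \<open>p\<close> and
    \<open>q\<close> span a line with \<open>a\<close> and \<open>b\<close> strictly on one
    side.\<close>
  ultimately obtain x where x: "x \<in> {a, b, p, q}" "x \<in> convex hull ({a, b, p, q} - {x})"
    using nested by blast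
  have ins: "{b, p, q} \<subseteq> convex hull T" "{a, p, q} \<subseteq> convex hull T"
    using P PT by blast+
  have notin: "a \<notin> {b, p, q}" "b \<notin> {a, p, q}" using ab(3) dist by blast+
  have "a \<notin> convex hull {b, p, q}" "b \<notin> convex hull {a, p, q}"
    using vertex_not_in_hull_of_inner_points[OF indep ab(1) ins(1) notin(1)]
      vertex_not_in_hull_of_inner_points[OF indep ab(2) ins(2) notin(2)] by this+
  moreover have "p \<notin> convex hull {a, b, q}" "q \<notin> convex hull {a, b, p}"
    using same_side_not_in_hull[OF ab(4) pq(3)] by this+
  moreover have "{a, b, p, q} - {a} = {b, p, q}" "{a, b, p, q} - {b} = {a, p, q}"
    "{a, b, p, q} - {p} = {a, b, q}" "{a, b, p, q} - {q} = {a, b, p}"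
    using ab(3) dist pq(3) by blast+
  moreover have "x = a \<or> x = b \<or> x = p \<or> x = q" using x(1) by blast
  ultimately show False using x(2) by metis
qed

lemma five_points_crossing:
  assumes gen: "generic P" and card: "card P \<ge> 5"
  obtains R B where "R \<subseteq> P" "B \<subseteq> P" "R \<inter> B = {}" "cr_RB R B \<ge> 1"
proof -
  obtain R B where RB: "R \<subseteq> P" "B \<subseteq> P" "R \<inter> B = {}" "card R = 2" "card B = 2"
    "convex hull R \<inter> convex hull B \<noteq> {}"
    using five_points_crossing_pairs[of P] gen card unfolding generic_def by metis
  have g: "generic R" "generic B" using generic_subset[OF gen] RB by auto
  have "R \<in> MST R" "B \<in> MST B"
    using MST_pair g RB(4,5) unfolding card_2_iff by metis+
  then have "{(e, f). e \<in> MST R \<and> f \<in> MST B \<and> convex hull e \<inter> convex hull f \<noteq> {}} \<noteq> {}"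
    using RB(6) by blast
  then have "cr_RB R B \<ge> 1"
    unfolding cr_RB_def using finite_crossings[OF g] by (simp add: Suc_le_eq card_gt_0_iff)
  then show ?thesis using that RB by blast
qed

section \<open>Finding well separated subsets\<close>

lemma compact_finite_ball_cover:
  fixes S :: "'a::metric_space set"
  assumes "compact S" "e > 0"
  obtains C where "finite C" "S \<subseteq> (\<Union>x\<in>C. ball x e)"
  using assms unfolding compact_eq_totally_bounded by blast

lemma farthest_point:
  fixes p :: "'a::metric_space"
  assumes "finite S" "S \<noteq> {}"
  obtains q where "q \<in> S" "S \<subseteq> cball p (dist p q)"
proof -
  have "Max (dist p ` S) \<in> dist p ` S" using assms by simp
  then obtain q where q: "q \<in> S" "Max (dist p ` S) = dist p q" by blast
  moreover have "dist p s \<le> dist p q" if "s \<in> S" for s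
    using that assms(1) by (simp flip: q(2))
  ultimately show ?thesis using that[of q] by (simp add: subset_iff)
qed

text \<open>The difference splits into a radial part of length \<open>norm y' - norm y\<close> and
  an angular part of length at most \<open>norm y / 2\<close>.\<close>

lemma dist_le_of_similar_direction:
  fixes y y' :: "'a::real_normed_vector"
  assumes "norm y \<le> norm y'" "dist (sgn y) (sgn y') \<le> 1/2"
  shows "dist y y' \<le> norm y' - norm y / 2"
proof -
  have polar: "norm z *\<^sub>R sgn z = z" for z :: 'a by (cases "z = 0") (simp_all add: sgn_div_norm)
  have "y' - y = (norm y' - norm y) *\<^sub>R sgn y' + norm y *\<^sub>R (sgn y' - sgn y)"
    by (simp add: algebra_simps polar)
  then have "norm (y' - y) \<le> (norm y' - norm y) * norm (sgn y') + norm y * norm (sgn y' - sgn y)"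
    using norm_triangle_ineq[of "(norm y' - norm y) *\<^sub>R sgn y'" "norm y *\<^sub>R (sgn y' - sgn y)"] assms(1)
    by simp
  also have "\<dots> \<le> (norm y' - norm y) * 1 + norm y * (1/2)"
    using assms by (intro add_mono mult_left_mono) (auto simp: norm_sgn dist_norm norm_minus_commute)
  finally show ?thesis by (simp add: dist_norm norm_minus_commute)
qed

text \<open>The factor 5 leaves room in both clauses. Cluster points are at most
  \<open>2 * r\<close> apart, while links to \<open>Y\<close> are longer than \<open>4 * r\<close>.
  If \<open>y\<close> is no farther from \<open>p\<close> than \<open>y'\<close>, then
  \<open>dist y y'\<close> is at most \<open>dist p y' - 5 * r / 2\<close>, whereas
  \<open>dist x' y'\<close> is at least \<open>dist p y' - r\<close>.\<close>

lemma well_separated_cluster_sector: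
  assumes A: "\<And>x. x \<in> A \<Longrightarrow> dist p x \<le> r"
    and far: "\<And>y. y \<in> Y \<Longrightarrow> 5 * r < dist p y"
    and sector: "\<And>y y'. y \<in> Y \<Longrightarrow> y' \<in> Y \<Longrightarrow> dist (sgn (y - p)) (sgn (y' - p)) \<le> 1/2"
  shows "well_separated A Y"
  unfolding well_separated_def
proof (intro conjI ballI)
  fix x x' y assume x: "x \<in> A" "x' \<in> A" and y: "y \<in> Y"
  have "0 \<le> r" using A[OF x(1)] zero_le_dist[of p x] by linarith
  then show "dist x x' < dist x y"
    using A[OF x(1)] A[OF x(2)] far[OF y]
      dist_triangle3[of x x' p] dist_triangle[of p y x] by linarith
next
  fix x x' y y' assume x: "x \<in> A" "x' \<in> A" and y: "y \<in> Y" "y' \<in> Y"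
  have r: "0 \<le> r" using A[OF x(1)] zero_le_dist[of p x] by linarith
  have close: "dist y y' \<le> dist p y' - 5 * r / 2" if "y \<in> Y" "y' \<in> Y" "dist p y \<le> dist p y'" for y y'
  proof -
    have "dist (y - p) (y' - p) \<le> norm (y' - p) - norm (y - p) / 2"
      using that sector by (intro dist_le_of_similar_direction) (auto simp: dist_norm norm_minus_commute)
    then show ?thesis
      using far[OF that(1)] by (simp add: dist_norm norm_minus_commute)
  qed
  have "dist p y \<le> dist x y + r" "dist p y' \<le> dist x' y' + r"
    using A[OF x(1)] A[OF x(2)] dist_triangle[of p y x] dist_triangle[of p y' x'] by auto
  then show "dist y y' \<le> max (dist x y) (dist x' y')"
    using close[OF y] close[OF y(2,1)] r by (cases "dist p y \<le> dist p y'") (auto simp: dist_commute)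
qed

lemma card_le_of_cover:
  assumes "finite C" "F \<subseteq> (\<Union>x\<in>C. G x)" "\<And>x. x \<in> C \<Longrightarrow> finite (G x) \<and> card (G x) \<le> m"
  shows "card F \<le> card C * m"
proof -
  have "card F \<le> card (\<Union>x\<in>C. G x)" using assms by (intro card_mono) auto
  also have "\<dots> \<le> (\<Sum>x\<in>C. card (G x))" using assms(1) by (rule card_UN_le)
  also have "\<dots> \<le> card C * m" using assms(3) sum_bounded_above[of C "\<lambda>x. card (G x)" m] by simp
  finally show ?thesis .
qed

text \<open>A disc centred in \<open>P\<close> can be shrunk to the farthest point of
  \<open>P\<close> that it contains. So only finitely many radii, the distances within
  \<open>P\<close>, compete, and a least one with \<open>m\<close> points exists.\<close>

lemma smallest_disc:
  fixes P :: "point set"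
  assumes fin: "finite P" and m: "2 \<le> m" "m \<le> card P"
  obtains p r where "r > 0" "m \<le> card (P \<inter> cball p r)"
    "\<And>p'. p' \<in> P \<Longrightarrow> card (P \<inter> cball p' (r / 2)) < m"
proof -
  define D where "D = {(p, q). p \<in> P \<and> q \<in> P \<and> m \<le> card (P \<inter> cball p (dist p q))}"
  have finD: "finite D" by (rule finite_subset[of _ "P \<times> P"]) (auto simp: D_def fin)
  have D_I: "\<exists>q. (p, q) \<in> D \<and> dist p q \<le> s" if p: "p \<in> P" "m \<le> card (P \<inter> cball p s)" for p s
  proof -
    let ?S = "P \<inter> cball p s"
    have "finite ?S" "?S \<noteq> {}" using fin p m by (auto simp: card_gt_0_iff dest: card_ge_0_finite)
    then obtain q where q: "q \<in> ?S" "?S \<subseteq> cball p (dist p q)" by (rule farthest_point)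
    then have "card ?S \<le> card (P \<inter> cball p (dist p q))" using fin by (intro card_mono) auto
    then have "(p, q) \<in> D" "dist p q \<le> s" using q(1) p by (simp_all add: D_def)
    then show ?thesis by blast
  qed
  have "P \<noteq> {}" using m by auto
  then obtain p0 where p0: "p0 \<in> P" by blast
  obtain q0 where "q0 \<in> P" "P \<subseteq> cball p0 (dist p0 q0)"
    using farthest_point[OF fin \<open>P \<noteq> {}\<close>] by blast
  then have "P \<inter> cball p0 (dist p0 q0) = P" by blast
  then have "D \<noteq> {}" using D_I[OF p0, of "dist p0 q0"] m(2) by auto
  define r where "r = Min ((\<lambda>(p, q). dist p q) ` D)"
  have "r \<in> (\<lambda>(p, q). dist p q) ` D"
    unfolding r_def using finD \<open>D \<noteq> {}\<close> by (intro Min_in) auto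
  then obtain p q where pq: "(p, q) \<in> D" "r = dist p q" by auto
  have min: "r \<le> dist p' q'" if "(p', q') \<in> D" for p' q'
    unfolding r_def using finD that by (intro Min_le) force+
  have card: "m \<le> card (P \<inter> cball p r)" using pq by (auto simp: D_def)
  \<comment> \<open>A disc of radius zero holds at most one point, fewer than
    \<open>m\<close>.\<close>
  have "r \<noteq> 0"
  proof
    assume "r = 0"
    then have "P \<inter> cball p r \<subseteq> {p}" by auto
    from card_mono[OF _ this] show False using card m(1) by simp
  qed
  then have "r > 0" using pq(2) by simp
  moreover have "card (P \<inter> cball p' (r / 2)) < m" if p': "p' \<in> P" for p'
  proof (rule ccontr)
    assume "\<not> ?thesis"
    then obtain q' where "(p', q') \<in> D" "dist p' q' \<le> r / 2" using D_I[OF p', of "r / 2"] by auto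
    then show False using min \<open>r > 0\<close> by fastforce
  qed
  ultimately show ?thesis using that card by blast
qed

text \<open>A five times larger disc is covered by boundedly many discs of half the minimal radius, so it
  contains only \<open>O(m)\<close> points. Of the points outside it, one narrow sector contains a constant
  fraction.\<close>
lemma well_separated_subsets:
  obtains K :: nat where "K \<ge> 2"
    "\<And>m P. 2 \<le> m \<Longrightarrow> finite P \<Longrightarrow> K * m \<le> card P \<Longrightarrow>
       \<exists>A Y. A \<subseteq> P \<and> Y \<subseteq> P \<and> m \<le> card A \<and> m \<le> card Y \<and> well_separated A Y"
proof -
  \<comment> \<open>Two points in a ball of radius \<open>1/4\<close> differ by at most
    \<open>1/2\<close>. Scaled by \<open>r\<close>, this fits the discs of radius
    \<open>r / 2\<close> with fewer than \<open>m\<close> points; for unit vectors, it is the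
    tolerance of \<open>well_separated_cluster_sector\<close>.\<close>
  have quarter: "(1/4::real) > 0" by simp
  obtain C1 where C1: "finite C1" "cball (0::point) 5 \<subseteq> (\<Union>x\<in>C1. ball x (1/4))"
    by (rule compact_finite_ball_cover[OF compact_cball quarter])
  obtain C2 where C2: "finite C2" "sphere (0::point) 1 \<subseteq> (\<Union>x\<in>C2. ball x (1/4))"
    by (rule compact_finite_ball_cover[OF compact_sphere quarter])
  have "C2 \<noteq> {}"
  proof
    assume "C2 = {}"
    then have "sphere (0::point) 1 = {}" using C2 by auto
    moreover have "(1, 0) \<in> sphere (0::point) 1" by (simp add: norm_Pair)
    ultimately show False by blast
  qed
  then have C2_pos: "card C2 > 0" using C2 by (simp add: card_gt_0_iff)
  \<comment> \<open>\<open>card C1\<close> pays for the points near the cluster and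
    \<open>card C2\<close> for the sectors; the additional 1 secures \<open>K >= 2\<close>.\<close>
  define K where "K = card C1 + card C2 + 1"
  have main: "\<exists>A Y. A \<subseteq> P \<and> Y \<subseteq> P \<and> m \<le> card A \<and> m \<le> card Y \<and> well_separated A Y"
    if m: "2 \<le> m" and fin: "finite P" and card: "K * m \<le> card P" for m and P :: "point set"
  proof -
    have "m \<le> K * m" by (simp add: K_def)
    then have "m \<le> card P" using card by (rule le_trans)
    then obtain p r where r: "r > 0" and A: "m \<le> card (P \<inter> cball p r)"
      and small: "\<And>p'. p' \<in> P \<Longrightarrow> card (P \<inter> cball p' (r / 2)) < m"
      using smallest_disc[OF fin m] by metis
    have near: "card (P \<inter> cball p (5 * r)) \<le> card C1 * m"
    proof (rule card_le_of_cover[OF C1(1)])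
      show "P \<inter> cball p (5 * r) \<subseteq> (\<Union>x\<in>C1. P \<inter> ball (p + r *\<^sub>R x) (r / 4))"
      proof
        fix y assume y: "y \<in> P \<inter> cball p (5 * r)"
        define z where "z = (1 / r) *\<^sub>R (y - p)"
        have yz: "y = p + r *\<^sub>R z" using r by (simp add: z_def)
        have "norm z = dist p y / r" using r by (simp add: z_def dist_norm norm_minus_commute)
        then have "z \<in> cball 0 5" using y r by (simp add: divide_le_eq)
        then obtain x where x: "x \<in> C1" "dist x z < 1/4" using C1(2) by auto
        have "dist (p + r *\<^sub>R x) y = norm (r *\<^sub>R (x - z))"
          by (simp add: yz dist_norm scaleR_diff_right)
        also have "\<dots> = r * dist x z" using r by (simp add: dist_norm)
        also have "\<dots> < r * (1/4)" using x(2) r by (intro mult_strict_left_mono)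
        finally have "y \<in> ball (p + r *\<^sub>R x) (r / 4)" by simp
        then show "y \<in> (\<Union>x\<in>C1. P \<inter> ball (p + r *\<^sub>R x) (r / 4))" using y x(1) by blast
      qed
      fix x assume "x \<in> C1"
      let ?S = "P \<inter> ball (p + r *\<^sub>R x) (r / 4)"
      \<comment> \<open>\<open>small\<close> speaks only of centres in \<open>P\<close>, so the ball
        is recentred at one of the points of \<open>P\<close> in it, at the price of doubling its
        radius.\<close>
      have "card ?S \<le> m"
      proof (cases "?S = {}")
        case True
        then show ?thesis by simp
      next
        case False
        then obtain p' where p': "p' \<in> ?S" by blast
        have "dist p' y \<le> r / 2" if "y \<in> ?S" for y
          using p' that dist_triangle3[of p' y "p + r *\<^sub>R x"] by simp
        then have "?S \<subseteq> P \<inter> cball p' (r / 2)" by auto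
        then have "card ?S \<le> card (P \<inter> cball p' (r / 2))" using fin by (intro card_mono) auto
        then show ?thesis using small[of p'] p' by simp
      qed
      then show "finite ?S \<and> card ?S \<le> m" using fin by simp
    qed
    define F where "F = P - cball p (5 * r)"
    have "P = (P \<inter> cball p (5 * r)) \<union> F" by (auto simp: F_def)
    then have "card P \<le> card (P \<inter> cball p (5 * r)) + card F" using card_Un_le by metis
    then have cardF: "card C2 * m \<le> card F"
      using card near by (simp add: K_def distrib_right)
    define G where "G x = {y \<in> F. sgn (y - p) \<in> ball x (1/4)}" for x
    have finG: "finite (G x)" for x using fin by (simp add: G_def F_def)
    have cover: "F \<subseteq> (\<Union>x\<in>C2. G x)"
    proof
      fix y assume y: "y \<in> F"
      then have "y \<noteq> p" using r by (auto simp: F_def)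
      then have "sgn (y - p) \<in> sphere 0 1" by (simp add: norm_sgn)
      then have "sgn (y - p) \<in> (\<Union>x\<in>C2. ball x (1/4))" by (rule subsetD[OF C2(2)])
      then show "y \<in> (\<Union>x\<in>C2. G x)" using y by (simp add: G_def)
    qed
    have "\<exists>x\<in>C2. m \<le> card (G x)"
    proof (rule ccontr)
      assume "\<not> ?thesis"
      then have "finite (G x) \<and> card (G x) \<le> m - 1" if "x \<in> C2" for x
        using that finG by fastforce
      then have "card F \<le> card C2 * (m - 1)" by (rule card_le_of_cover[OF C2(1) cover])
      also have "\<dots> < card C2 * m" using C2_pos m by simp
      finally show False using cardF by simp
    qed
    then obtain x where x: "m \<le> card (G x)" by blast
    have "well_separated (P \<inter> cball p r) (G x)"
    proof (rule well_separated_cluster_sector[of _ p r])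
      fix y y' assume "y \<in> G x" "y' \<in> G x"
      then show "dist (sgn (y - p)) (sgn (y' - p)) \<le> 1/2"
        using dist_triangle3[of "sgn (y - p)" "sgn (y' - p)" x] by (simp add: G_def)
    qed (auto simp: G_def F_def)
    moreover have "G x \<subseteq> P" by (auto simp: G_def F_def)
    ultimately show ?thesis using A x by blast
  qed
  have "K \<ge> 2" using C2_pos by (simp add: K_def)
  then show ?thesis using that main by blast
qed

section \<open>Iteration and the logarithmic bound\<close>

text \<open>A factor \<open>K\<close> in the number of points buys a factor 2 in crossings, one half
  from each of two well separated subsets. The start value 5 is the size at which a crossing is
  guaranteed.\<close>

lemma exponential_crossings:
  obtains K :: nat where "K \<ge> 2"
    "\<And>j P. generic P \<Longrightarrow> 5 * K ^ j \<le> card P \<Longrightarrow>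
       \<exists>R B. R \<subseteq> P \<and> B \<subseteq> P \<and> R \<inter> B = {} \<and> 2 ^ j \<le> cr_RB R B"
proof -
  obtain K :: nat where K: "K \<ge> 2"
    and split: "\<And>m P. 2 \<le> m \<Longrightarrow> finite P \<Longrightarrow> K * m \<le> card P \<Longrightarrow>
       \<exists>A Y. A \<subseteq> P \<and> Y \<subseteq> P \<and> m \<le> card A \<and> m \<le> card Y \<and> well_separated A Y"
    using well_separated_subsets by metis
  have "\<exists>R B. R \<subseteq> P \<and> B \<subseteq> P \<and> R \<inter> B = {} \<and> 2 ^ j \<le> cr_RB R B"
    if "generic P" "5 * K ^ j \<le> card P" for j P
    using that
  proof (induction j arbitrary: P)
    case 0
    then have "5 \<le> card P" by simp
    then obtain R B where "R \<subseteq> P" "B \<subseteq> P" "R \<inter> B = {}" "1 \<le> cr_RB R B"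
      using five_points_crossing[OF 0(1)] by metis
    then show ?case by auto
  next
    case (Suc j)
    have "K ^ j \<ge> 1" using K by simp
    then have "2 \<le> 5 * K ^ j" by linarith
    moreover have "finite P" using Suc.prems(1) by (simp add: generic_def)
    moreover have "K * (5 * K ^ j) \<le> card P" using Suc.prems(2) by (simp add: mult.left_commute)
    ultimately obtain A Y where AY: "A \<subseteq> P" "Y \<subseteq> P" "5 * K ^ j \<le> card A" "5 * K ^ j \<le> card Y"
      and sep: "well_separated A Y"
      using split by meson
    obtain R1 B1 where 1: "R1 \<subseteq> A" "B1 \<subseteq> A" "R1 \<inter> B1 = {}" "2 ^ j \<le> cr_RB R1 B1"
      using Suc.IH[OF generic_subset[OF Suc.prems(1) AY(1)] AY(3)] by blast
    obtain R2 B2 where 2: "R2 \<subseteq> Y" "B2 \<subseteq> Y" "R2 \<inter> B2 = {}" "2 ^ j \<le> cr_RB R2 B2"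
      using Suc.IH[OF generic_subset[OF Suc.prems(1) AY(2)] AY(4)] by blast
    have "2 ^ Suc j \<le> cr_RB (R1 \<union> R2) (B1 \<union> B2)"
      using cr_RB_well_separated[OF Suc.prems(1) sep AY(1,2) 1(1) 2(1) 1(2) 2(2)] 1(4) 2(4)
      by simp
    moreover have "R1 \<union> R2 \<subseteq> P" "B1 \<union> B2 \<subseteq> P" using 1 2 AY by blast+
    moreover have "(R1 \<union> R2) \<inter> (B1 \<union> B2) = {}"
      using 1 2 well_separated_disjoint[OF sep] by blast
    ultimately show ?case by blast
  qed
  then show ?thesis using that K by blast
qed

lemma cr_RB_le_cr:
  assumes "finite R" "finite B" "R \<inter> B = {}"
  shows "cr_RB R B \<le> cr (R \<union> B)"
proof -
  have "finite ((\<lambda>(R, B). cr_RB R B) ` (Pow (R \<union> B) \<times> Pow (R \<union> B)))"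
    using assms by simp
  then have "finite {cr_RB R' B' | R' B'. R' \<union> B' = R \<union> B \<and> R' \<inter> B' = {}}"
    by (rule rev_finite_subset) (auto simp: image_iff)
  then show ?thesis
    unfolding cr_def using assms(3) by (intro Max_ge) auto
qed

text \<open>The factor 4 absorbs the small cases; without it the estimate already fails at
  \<open>j = 1\<close>. From \<open>j = 3\<close> on, the square at most doubles from one step to
  the next.\<close>

lemma Suc_square_le_power_2: "(j + 1)\<^sup>2 \<le> 4 * (2::nat) ^ j"
proof (induction j rule: nat_less_induct)
  case (1 j)
  show ?case
  proof (cases "j \<le> 2")
    case True
    then have "j = 0 \<or> j = 1 \<or> j = 2" by linarith
    then show ?thesis by (auto simp: power2_eq_square)
  next
    case False
    then obtain i where i: "j = Suc i" "i \<ge> 2" by (cases j) auto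
    then have "2 * 2 \<le> i * i" by (intro mult_mono) auto
    then have "(j + 1)\<^sup>2 \<le> 2 * (i + 1)\<^sup>2" using i by (simp add: power2_eq_square)
    also have "\<dots> \<le> 4 * 2 ^ j" using 1 i by simp
    finally show ?thesis .
  qed
qed

theorem theorem3:
  shows "\<exists>c::real. c > 0 \<and> (\<exists>n0::nat. \<forall>P::point set.
           generic P \<and> card P \<ge> n0 \<longrightarrow>
           (\<exists>Q\<subseteq>P. real (cr Q) \<ge> c * (log 2 (real (card P)))\<^sup>2))"
proof -
  obtain K :: nat where K: "K \<ge> 2"
    and crossings: "\<And>j P. generic P \<Longrightarrow> 5 * K ^ j \<le> card P \<Longrightarrow>
       \<exists>R B. R \<subseteq> P \<and> B \<subseteq> P \<and> R \<inter> B = {} \<and> 2 ^ j \<le> cr_RB R B"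
    using exponential_crossings by metis
  \<comment> \<open>Chosen so that \<open>card P < 5 * K ^ (j + 1)\<close> gives the bound
    \<open>(j + 1) * D\<close> for the logarithm; the constant \<open>log 2 5\<close> is enlarged by
    the factor \<open>j + 1\<close> as well.\<close>
  define D where "D = log 2 5 + log 2 (real K)"
  have log_pos: "0 < log 2 (5::real)" "0 < log 2 (real K)" using K by simp_all
  then have D: "D > 0" unfolding D_def by (rule add_pos_pos)
  have main: "\<exists>Q\<subseteq>P. real (cr Q) \<ge> 1 / (4 * D\<^sup>2) * (log 2 (real (card P)))\<^sup>2"
    if P: "generic P" "card P \<ge> 5" for P
  proof -
    have "1 \<le> card P div 5" using P(2) by linarith
    \<comment> \<open>\<open>j\<close> is the largest exponent with
      \<open>5 * K ^ j <= card P\<close>: the lower bound yields the crossings, the upper one limits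
      the logarithm.\<close>
    then obtain j where j: "K ^ j \<le> card P div 5" "card P div 5 < K ^ (j + 1)"
      using ex_power_ivl1[OF K] by blast
    have lower: "5 * K ^ j \<le> card P" and upper: "card P < 5 * K ^ (j + 1)"
      using j by linarith+
    obtain R B where RB: "R \<subseteq> P" "B \<subseteq> P" "R \<inter> B = {}" "2 ^ j \<le> cr_RB R B"
      using crossings[OF P(1) lower] by blast
    have fin: "finite P" using P(1) by (simp add: generic_def)
    have "2 ^ j \<le> cr (R \<union> B)"
      using RB(4) cr_RB_le_cr[OF finite_subset[OF RB(1) fin] finite_subset[OF RB(2) fin] RB(3)]
      by (rule le_trans)
    then have cr: "2 ^ j \<le> real (cr (R \<union> B))"
      by (metis of_nat_le_iff of_nat_numeral of_nat_power)
    have "real (card P) \<le> real (5 * K ^ (j + 1))"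
      unfolding of_nat_le_iff using upper by (rule less_imp_le)
    then have "real (card P) \<le> 5 * real K ^ (j + 1)" by simp
    then have "log 2 (real (card P)) \<le> log 2 (5 * real K ^ (j + 1))"
      using P(2) by (intro log_mono) simp_all
    also have "\<dots> = log 2 5 + real (j + 1) * log 2 (real K)"
      using K by (simp add: log_mult log_nat_power del: power_Suc)
    also have "\<dots> \<le> real (j + 1) * D"
      using log_pos by (simp add: D_def algebra_simps)
    finally have "log 2 (real (card P)) \<le> real (j + 1) * D" .
    moreover have "0 \<le> log 2 (real (card P))" using P(2) by simp
    ultimately have "(log 2 (real (card P)))\<^sup>2 \<le> (real (j + 1) * D)\<^sup>2" by (intro power_mono)
    also have "\<dots> = real ((j + 1)\<^sup>2) * D\<^sup>2" by (simp add: power_mult_distrib)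
    also have "\<dots> \<le> real (4 * 2 ^ j) * D\<^sup>2"
      using Suc_square_le_power_2[of j] by (intro mult_right_mono) (simp_all only: of_nat_le_iff zero_le_power2)
    also have "\<dots> \<le> 4 * D\<^sup>2 * real (cr (R \<union> B))"
      using mult_left_mono[OF cr, of "4 * D\<^sup>2"] by (simp add: mult_ac)
    finally have "1 / (4 * D\<^sup>2) * (log 2 (real (card P)))\<^sup>2 \<le> real (cr (R \<union> B))"
      using D by (simp add: field_simps)
    moreover have "R \<union> B \<subseteq> P" using RB(1,2) by (rule Un_least)
    ultimately show ?thesis by blast
  qed
  show ?thesis
  proof (intro exI[of _ "1 / (4 * D\<^sup>2)"] exI[of _ 5] conjI allI impI)
    show "1 / (4 * D\<^sup>2) > 0" using D by simp
    fix P :: "point set"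
    assume "generic P \<and> 5 \<le> card P"
    then show "\<exists>Q\<subseteq>P. real (cr Q) \<ge> 1 / (4 * D\<^sup>2) * (log 2 (real (card P)))\<^sup>2"
      using main by simp
  qed
qed

end
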